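(* Let $M$ be a matroid of corank two, let $B_0$ be any basis, and let $R=E\setminus B_0$ (a two-element set). Then $R$ is the only stratum that can be dead, and when it is dead every pure multicomplex in $\mathbb N^R$ with degree sequence $h(K_R)$ is an unconditional fibre at $R$, and such a multicomplex exists. Consequently, for every basis $B_0$ of a matroid $M$ of corank two, $(M,B_0)$ carries a fibre system, and Stanley's conjecture holds for these matroids, i.e. $h(M)$ is a pure $O$-sequence.
   Context: $M$ is a matroid on a finite ground set $E$; corank means $|E|-r(M)$. For $i\in R=E\setminus B_0$, $C_i$ is the fundamental circuit, the unique circuit in $B_0\cup\{i\}$. For $\sigma\subseteq R$ put $m_\sigma(e)=\#\{i\in\sigma:e\in C_i\}$, $U_\sigma=\{e:m_\sigma(e)=1\}$, $A_\sigma=\{e:m_\sigma(e)\ge1\}$. A stratum is a nonempty $\sigma\subseteq R$; it is dead if $U_\sigma$ is independent in $M$, live otherwise. The baseline $b_\sigma\in\mathbb N^\sigma$ is $b_\sigma(i)=|C_i\cap U_\sigma|$; $\mathbb N^\sigma$ is identified with the vectors in $\mathbb N^R$ vanishing outside $\sigma$. $\sigma$ can be fired from $a\in\mathbb N^R$ if $a_i\ge b_\sigma(i)$ for all $i\in\sigma$. For dead $\sigma$, the dead node is $K_\sigma=(M|A_\sigma)/U_\sigma$. For a matroid $N$ of rank $d$, $h(N)=(h_0,\dots,h_d)$ is the $h$-vector of its independence complex: $T_N(x,1)=\sum_kh_kx^{d-k}$. A multicomplex is a finite set of monomials (exponent vectors) closed under division; it is pure if all maximal elements have the same degree $|a|=\sum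 a_i$; its degree sequence counts elements of each degree (trailing zeros ignored). A pure $O$-sequence is the degree sequence of a pure multicomplex. Fibres (recursively along inclusion): given fibres $F(\tau)$ at all dead $\tau\subsetneq\sigma$, a fibre at a dead stratum $\sigma$ is a set $F(\sigma)\subseteq\mathbb N^\sigma$ such that (i) $F(\sigma)$ is a pure multicomplex with degree sequence $h(K_\sigma)$; (ii) for every $m\in F(\sigma)$, every stratum $\tau\subsetneq\sigma$ that can be fired from $b_\sigma+m$ is dead with $(b_\sigma+m)|_\tau-b_\tau\in F(\tau)$. An unconditional fibre at $\sigma$ is a set satisfying (i) such that for every $m\in F(\sigma)$, every stratum $\tau\subsetneq\sigma$ that can be fired from $b_\sigma+m$ is dead with $(b_\sigma+m)|_\tau=b_\tau$. A fibre system on $(M,B_0)$ is a choice of a fibre at every dead stratum. *)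

theory Defs
  imports "HOL-Computational_Algebra.Polynomial"
begin

section \<open>Matroids on a finite ground set\<close>

datatype 'a set_system = Set_System (ground: "'a set") (indeps: "'a set set")

definition matroid :: "'a set_system \<Rightarrow> bool" where
  "matroid M \<longleftrightarrow>
     finite (ground M) \<and>
     indeps M \<subseteq> Pow (ground M) \<and>
     {} \<in> indeps M \<and>
     (\<forall>X Y. Y \<in> indeps M \<and> X \<subseteq> Y \<longrightarrow> X \<in> indeps M) \<and>
     (\<forall>X Y. X \<in> indeps M \<and> Y \<in> indeps M \<and> card X < card Y \<longrightarrow>
        (\<exists>y\<in>Y - X. insert y X \<in> indeps M))"

definition basis :: "'a set_system \<Rightarrow> 'a set \<Rightarrow> bool" where
  "basis M B \<longleftrightarrow> B \<in> indeps M \<and> (\<forall>X\<in>indeps M. B \<subseteq> X \<longrightarrow> X = B)"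

definition circuit :: "'a set_system \<Rightarrow> 'a set \<Rightarrow> bool" where
  "circuit M C \<longleftrightarrow> C \<subseteq> ground M \<and> C \<notin> indeps M \<and> (\<forall>X. X \<subset> C \<longrightarrow> X \<in> indeps M)"

definition rank_of :: "'a set_system \<Rightarrow> 'a set \<Rightarrow> nat" where
  "rank_of M A = Max (card ` {X \<in> indeps M. X \<subseteq> A})"

definition rank :: "'a set_system \<Rightarrow> nat" where
  "rank M = rank_of M (ground M)"

definition corank :: "'a set_system \<Rightarrow> nat" where
  "corank M = card (ground M) - rank M"

definition restrict :: "'a set_system \<Rightarrow> 'a set \<Rightarrow> 'a set_system" where
  "restrict M A = Set_System (ground M \<inter> A) {X \<in> indeps M. X \<subseteq> A}"

definition contract :: "'a set_system \<Rightarrow> 'a set \<Rightarrow> 'a set_system" where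
  "contract M A = Set_System (ground M - A)
     {X. X \<subseteq> ground M - A \<and> (\<exists>I. basis (restrict M A) I \<and> X \<union> I \<in> indeps M)}"


section \<open>Tutte polynomial and h-vector\<close>

text \<open>
  The Tutte polynomial
  \<open>T(x,y) = \<Sum>\<^sub>A (x - 1)\<^bsup>r(E) - r(A)\<^esup> (y - 1)\<^bsup>|A| - r(A)\<^esup>\<close>,
  as a polynomial in \<open>y\<close> with coefficients in \<open>\<int>[x]\<close>; hence \<open>T(x,1)\<close> is
  \<open>poly (tutte M) 1\<close>.
\<close>

definition tutte :: "'a set_system \<Rightarrow> int poly poly" where
  "tutte M = (\<Sum>A\<in>Pow (ground M).
     [: [:-1, 1:] ^ (rank M - rank_of M A) :] * [:-1, 1:] ^ (card A - rank_of M A))"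

text \<open>
  \<open>T(x,1) = \<Sum>\<^sub>k h\<^sub>k x\<^bsup>d - k\<^esup>\<close> where \<open>d\<close> is the rank. Sequences are extended by zero, so
  that equality of functions is equality up to trailing zeros.
\<close>

definition h_vector :: "'a set_system \<Rightarrow> nat \<Rightarrow> int" where
  "h_vector M k = (if k \<le> rank M then coeff (poly (tutte M) 1) (rank M - k) else 0)"


section \<open>Multicomplexes and pure O-sequences\<close>

text \<open>
  A monomial with variables indexed by \<open>S\<close> is an exponent function vanishing outside \<open>S\<close>.
  Divisibility is the pointwise order on functions.
\<close>

definition exponents :: "'v set \<Rightarrow> ('v \<Rightarrow> nat) set" where
  "exponents S = {a. \<forall>i. i \<notin> S \<longrightarrow> a i = 0}"

definition multicomplex :: "'v set \<Rightarrow> ('v \<Rightarrow> nat) set \<Rightarrow> bool" where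
  "multicomplex S F \<longleftrightarrow>
     F \<subseteq> exponents S \<and> finite F \<and> (\<forall>a\<in>F. \<forall>b. b \<le> a \<longrightarrow> b \<in> F)"

definition maximal_in :: "('v \<Rightarrow> nat) set \<Rightarrow> ('v \<Rightarrow> nat) \<Rightarrow> bool" where
  "maximal_in F a \<longleftrightarrow> a \<in> F \<and> (\<forall>b\<in>F. a \<le> b \<longrightarrow> b = a)"

definition pure_multicomplex :: "'v set \<Rightarrow> ('v \<Rightarrow> nat) set \<Rightarrow> bool" where
  "pure_multicomplex S F \<longleftrightarrow>
     multicomplex S F \<and>
     (\<forall>a b. maximal_in F a \<and> maximal_in F b \<longrightarrow> sum a S = sum b S)"

definition degree_sequence :: "'v set \<Rightarrow> ('v \<Rightarrow> nat) set \<Rightarrow> nat \<Rightarrow> int" where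
  "degree_sequence S F k = int (card {a \<in> F. sum a S = k})"

definition pure_O_sequence :: "(nat \<Rightarrow> int) \<Rightarrow> bool" where
  "pure_O_sequence h \<longleftrightarrow>
     (\<exists>(n::nat) F. pure_multicomplex {..<n} F \<and> degree_sequence {..<n} F = h)"


section \<open>Strata of a matroid with a chosen basis\<close>

definition fund_circuit :: "'a set_system \<Rightarrow> 'a set \<Rightarrow> 'a \<Rightarrow> 'a set" where
  "fund_circuit M B i = (THE C. circuit M C \<and> C \<subseteq> insert i B)"

definition cover_mult :: "'a set_system \<Rightarrow> 'a set \<Rightarrow> 'a set \<Rightarrow> 'a \<Rightarrow> nat" where
  "cover_mult M B \<sigma> e = card {i \<in> \<sigma>. e \<in> fund_circuit M B i}"

definition covered_once :: "'a set_system \<Rightarrow> 'a set \<Rightarrow> 'a set \<Rightarrow> 'a set" where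
  "covered_once M B \<sigma> = {e \<in> ground M. cover_mult M B \<sigma> e = 1}"

definition covered :: "'a set_system \<Rightarrow> 'a set \<Rightarrow> 'a set \<Rightarrow> 'a set" where
  "covered M B \<sigma> = {e \<in> ground M. cover_mult M B \<sigma> e \<ge> 1}"

definition stratum :: "'a set_system \<Rightarrow> 'a set \<Rightarrow> 'a set \<Rightarrow> bool" where
  "stratum M B \<sigma> \<longleftrightarrow> \<sigma> \<noteq> {} \<and> \<sigma> \<subseteq> ground M - B"

definition dead :: "'a set_system \<Rightarrow> 'a set \<Rightarrow> 'a set \<Rightarrow> bool" where
  "dead M B \<sigma> \<longleftrightarrow> stratum M B \<sigma> \<and> covered_once M B \<sigma> \<in> indeps M"

definition baseline :: "'a set_system \<Rightarrow> 'a set \<Rightarrow> 'a set \<Rightarrow> 'a \<Rightarrow> nat" where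
  "baseline M B \<sigma> i =
     (if i \<in> \<sigma> then card (fund_circuit M B i \<inter> covered_once M B \<sigma>) else 0)"

definition can_fire :: "'a set_system \<Rightarrow> 'a set \<Rightarrow> 'a set \<Rightarrow> ('a \<Rightarrow> nat) \<Rightarrow> bool" where
  "can_fire M B \<sigma> a \<longleftrightarrow> (\<forall>i\<in>\<sigma>. baseline M B \<sigma> i \<le> a i)"

definition dead_node :: "'a set_system \<Rightarrow> 'a set \<Rightarrow> 'a set \<Rightarrow> 'a set_system" where
  "dead_node M B \<sigma> = contract (restrict M (covered M B \<sigma>)) (covered_once M B \<sigma>)"


section \<open>Fibres\<close>

definition restrict_vec :: "'v set \<Rightarrow> ('v \<Rightarrow> nat) \<Rightarrow> 'v \<Rightarrow> nat" where
  "restrict_vec S a i = (if i \<in> S then a i else 0)"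

definition fibre_candidate ::
    "'a set_system \<Rightarrow> 'a set \<Rightarrow> 'a set \<Rightarrow> ('a \<Rightarrow> nat) set \<Rightarrow> bool" where
  "fibre_candidate M B \<sigma> G \<longleftrightarrow>
     pure_multicomplex \<sigma> G \<and> degree_sequence \<sigma> G = h_vector (dead_node M B \<sigma>)"

text \<open>
  \<open>G\<close> is a fibre at \<open>\<sigma>\<close>, given the fibres \<open>F \<tau>\<close> at the dead \<open>\<tau> \<subset> \<sigma>\<close>.
  The subtraction of naturals does not truncate, since \<open>\<tau>\<close> can be fired.
\<close>

definition fibre ::
    "'a set_system \<Rightarrow> 'a set \<Rightarrow> ('a set \<Rightarrow> ('a \<Rightarrow> nat) set) \<Rightarrow> 'a set \<Rightarrow> ('a \<Rightarrow> nat) set \<Rightarrow> bool"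
  where
  "fibre M B F \<sigma> G \<longleftrightarrow>
     dead M B \<sigma> \<and> fibre_candidate M B \<sigma> G \<and>
     (\<forall>m\<in>G. \<forall>\<tau>. stratum M B \<tau> \<and> \<tau> \<subset> \<sigma> \<and>
        can_fire M B \<tau> (\<lambda>i. baseline M B \<sigma> i + m i) \<longrightarrow>
        dead M B \<tau> \<and>
        (\<lambda>i. restrict_vec \<tau> (\<lambda>j. baseline M B \<sigma> j + m j) i - baseline M B \<tau> i) \<in> F \<tau>)"

definition unconditional_fibre ::
    "'a set_system \<Rightarrow> 'a set \<Rightarrow> 'a set \<Rightarrow> ('a \<Rightarrow> nat) set \<Rightarrow> bool" where
  "unconditional_fibre M B \<sigma> G \<longleftrightarrow>
     dead M B \<sigma> \<and> fibre_candidate M B \<sigma> G \<and>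
     (\<forall>m\<in>G. \<forall>\<tau>. stratum M B \<tau> \<and> \<tau> \<subset> \<sigma> \<and>
        can_fire M B \<tau> (\<lambda>i. baseline M B \<sigma> i + m i) \<longrightarrow>
        dead M B \<tau> \<and>
        restrict_vec \<tau> (\<lambda>i. baseline M B \<sigma> i + m i) = baseline M B \<tau>)"

definition fibre_system ::
    "'a set_system \<Rightarrow> 'a set \<Rightarrow> ('a set \<Rightarrow> ('a \<Rightarrow> nat) set) \<Rightarrow> bool" where
  "fibre_system M B F \<longleftrightarrow> (\<forall>\<sigma>. dead M B \<sigma> \<longrightarrow> fibre M B F \<sigma> (F \<sigma>))"


section \<open>Well-definedness checks\<close>

lemma fund_circuit_unique:
  assumes M: "matroid M" and B: "basis M B" and i: "i \<in> ground M - B"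
  shows "\<exists>!C. circuit M C \<and> C \<subseteq> insert i B"
proof -
  have fin: "finite (ground M)" using M by (simp add: matroid_def)
  have sub: "X \<subseteq> ground M" if "X \<in> indeps M" for X
    using M that by (auto simp: matroid_def)
  have down: "X \<in> indeps M" if "Y \<in> indeps M" "X \<subseteq> Y" for X Y
    using M that unfolding matroid_def by metis
  have aug: "\<exists>y\<in>Y - X. insert y X \<in> indeps M"
    if "X \<in> indeps M" "Y \<in> indeps M" "card X < card Y" for X Y
    using M that unfolding matroid_def by metis
  have BI: "B \<in> indeps M" and Bmax: "\<And>X. X \<in> indeps M \<Longrightarrow> B \<subseteq> X \<Longrightarrow> X = B"
    using B by (auto simp: basis_def)
  have finB: "finite (insert i B)" using fin sub[OF BI] finite_subset by auto
  have dep: "insert i B \<notin> indeps M" using Bmax i by blast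
  define P where "P X \<longleftrightarrow> X \<subseteq> insert i B \<and> X \<notin> indeps M" for X
  have "P (insert i B)" using dep by (simp add: P_def)
  then obtain C where C: "P C" and Cmin: "\<And>X. P X \<Longrightarrow> card C \<le> card X"
    using ex_has_least_nat[of P _ card] by metis
  have finC: "finite C" using C finB finite_subset by (auto simp: P_def)
  have "X \<in> indeps M" if "X \<subset> C" for X
    using that C Cmin[of X] psubset_card_mono[OF finC that] by (auto simp: P_def)
  hence circ: "circuit M C" using C i sub[OF BI] by (auto simp: circuit_def P_def)
  have uniq: "C1 \<subseteq> C2" if c: "circuit M C1" "C1 \<subseteq> insert i B" "circuit M C2" "C2 \<subseteq> insert i B"
    for C1 C2
  proof (rule ccontr)
    assume "\<not> C1 \<subseteq> C2"
    then obtain e where e: "e \<in> C1" "e \<notin> C2" by blast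
    have indep_not: "\<not> circuit M D" if "D \<subseteq> Z" "Z \<in> indeps M" for D Z
      using down[OF that(2,1)] by (simp add: circuit_def)
    have i2: "i \<in> C2" using c(3,4) indep_not[OF _ BI] by blast
    define X where "X = C1 - {e}"
    have XI: "X \<in> indeps M" using c(1) e by (auto simp: circuit_def X_def)
    have XJ: "X \<subseteq> insert i B - {e}" using c by (auto simp: X_def)
    define Q where "Q Y \<longleftrightarrow> Y \<in> indeps M \<and> X \<subseteq> Y \<and> Y \<subseteq> insert i B" for Y
    have bd: "\<forall>Y. Q Y \<longrightarrow> card Y < Suc (card (insert i B))"
      using finB by (auto simp: Q_def less_Suc_eq_le intro: card_mono)
    have "Q X" using XI XJ by (auto simp: Q_def)
    then obtain Y where Y: "Q Y" and Ymax: "\<And>Z. Q Z \<Longrightarrow> card Z \<le> card Y"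
      using ex_has_greatest_nat[of Q X card] bd by blast
    have finY: "finite Y" using Y finB finite_subset by (auto simp: Q_def)
    have "card B \<le> card Y"
    proof (rule ccontr)
      assume "\<not> card B \<le> card Y"
      then obtain y where "y \<in> B - Y" "insert y Y \<in> indeps M"
        using aug[of Y B] Y BI by (auto simp: Q_def)
      hence "Q (insert y Y)" using Y by (auto simp: Q_def)
      from Ymax[OF this] show False using \<open>y \<in> B - Y\<close> finY by auto
    qed
    moreover have "e \<notin> Y"
    proof
      assume "e \<in> Y"
      hence "C1 \<subseteq> Y" using Y by (auto simp: Q_def X_def)
      thus False using c(1) indep_not[of C1 Y] Y by (simp add: Q_def)
    qed
    moreover have "card (insert i B - {e}) = card B"
      using e c i i2 finB by (auto simp: card_insert_if)
    moreover have "Y \<subseteq> insert i B - {e}" using Y \<open>e \<notin> Y\<close> by (auto simp: Q_def)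
    ultimately have "Y = insert i B - {e}"
      using finB by (metis card_seteq finite_Diff)
    hence "C2 \<subseteq> Y" using c e by auto
    thus False using c(3) indep_not[of C2 Y] Y by (simp add: Q_def)
  qed
  show ?thesis
    using circ C uniq by (intro ex1I[of _ C]) (auto simp: P_def)
qed

lemma tutte_at_1:
  assumes "matroid M"
  shows "poly (tutte M) 1 = (\<Sum>A\<in>indeps M. [:-1, 1:] ^ (rank M - card A))"
proof -
  have fin: "finite (ground M)" and sub: "indeps M \<subseteq> Pow (ground M)" and "{} \<in> indeps M"
    using assms by (simp_all add: matroid_def)
  have finI: "finite (indeps M)" using fin sub finite_subset by auto
  have r: "rank_of M A = card A \<longleftrightarrow> A \<in> indeps M" "rank_of M A \<le> card A"
    if "A \<subseteq> ground M" for A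
  proof -
    let ?S = "card ` {X \<in> indeps M. X \<subseteq> A}"
    have finA: "finite A" using that fin finite_subset by auto
    have S: "finite ?S" "?S \<noteq> {}" using finI \<open>{} \<in> indeps M\<close> by auto
    have le: "\<And>n. n \<in> ?S \<Longrightarrow> n \<le> card A" using finA by (auto intro: card_mono)
    show "rank_of M A \<le> card A" unfolding rank_of_def using Max_in[OF S] le by blast
    show "rank_of M A = card A \<longleftrightarrow> A \<in> indeps M"
    proof
      assume "rank_of M A = card A"
      then obtain X where "X \<in> indeps M" "X \<subseteq> A" "card X = card A"
        using Max_in[OF S] unfolding rank_of_def by auto
      thus "A \<in> indeps M" using card_subset_eq[OF finA] by auto
    next
      assume "A \<in> indeps M"
      thus "rank_of M A = card A" unfolding rank_of_def
        using S le by (intro Max_eqI) auto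
    qed
  qed
  have "poly (tutte M) 1 =
    (\<Sum>A\<in>Pow (ground M). [:-1, 1:] ^ (rank M - rank_of M A) * 0 ^ (card A - rank_of M A))"
    by (simp add: tutte_def poly_sum)
  also have "\<dots> = (\<Sum>A\<in>Pow (ground M).
      if A \<in> indeps M then [:-1, 1:] ^ (rank M - card A) else 0)"
  proof (rule sum.cong[OF refl])
    fix A assume "A \<in> Pow (ground M)"
    hence A: "A \<subseteq> ground M" by simp
    show "[:-1, 1:] ^ (rank M - rank_of M A) * 0 ^ (card A - rank_of M A)
        = (if A \<in> indeps M then [:-1, 1:] ^ (rank M - card A) else (0 :: int poly))"
      using r[OF A] by (auto simp: power_0_left)
  qed
  also have "\<dots> = (\<Sum>A\<in>indeps M. [:-1, 1:] ^ (rank M - card A))"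
    using fin sub by (simp add: sum.inter_restrict[symmetric] Int_absorb1)
  finally show ?thesis .
qed

end

theory Submission
  imports Defs
begin

text \<open>
  Let \<open>E\<close> be the ground set and \<open>R = {i, j}\<close>, with fundamental circuits \<open>C\<close> and \<open>D\<close>. A
  one-element stratum is live because the elements it covers once form a circuit. If \<open>R\<close> is dead,
  its node \<open>K\<close> has ground set \<open>C \<inter> D\<close> and corank two, so the monomials of a multicomplex with
  degree sequence \<open>h(K)\<close> have degree at most \<open>|C \<inter> D| - 2\<close>. The baseline of
  \<open>R\<close> at \<open>i\<close> is \<open>|C - D|\<close>, while firing \<open>{i}\<close> needs \<open>|C|\<close>, so the monomial would have to contribute
  the missing \<open>|C \<inter> D|\<close>. Hence no proper stratum ever fires (\<open>no_singleton_fires\<close>), and the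
  conditions on fired strata hold vacuously, for fibres and for unconditional fibres.

  What remains, for \<open>K\<close> and for \<open>M\<close> itself, is that the h-vector of a matroid of corank two is the
  degree sequence of a pure multicomplex in two variables. The dual has rank two, so it consists
  of loops and of parallel classes, of sizes \<open>p\<^sub>1, \<dots>, p\<^sub>s\<close> with sum \<open>n\<close>, say, and a set is
  independent iff its complement meets two classes (\<open>corank_two_parallel_classes\<close>). Since
  \<open>(x - 1)\<^bsup>|D|\<^esup>\<close> summed over the subsets \<open>D\<close> of a set \<open>A\<close> is \<open>x\<^bsup>|A|\<^esup>\<close>, this gives
  \<open>(x - 1)\<^sup>2 T(x, 1) = x\<^bsup>|E| - n\<^esup> (x\<^sup>n - \<Sum> x\<^bsup>p\<^esup> + s - 1)\<close>.
  In the bracket divided by \<open>(x - 1)\<^sup>2\<close>, the coefficient of \<open>x\<^bsup>n - 2 - k\<^esup>\<close> is the number of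
  monomials of degree \<open>k\<close> in a staircase with steps of width \<open>p\<^sub>1, \<dots>, p\<^bsub>s - 1\<^esub>\<close> and height
  \<open>p\<^sub>2, \<dots>, p\<^sub>s\<close> (\<open>staircase_generating_function\<close>), and all corners of this staircase have
  degree \<open>n - 2\<close>.
\<close>

section \<open>Independent sets and rank\<close>

lemma indep_subset:
  assumes "matroid M" "Y \<in> indeps M" "X \<subseteq> Y"
  shows "X \<in> indeps M"
  using assms unfolding matroid_def by metis

lemma indep_in_ground:
  assumes "matroid M" "X \<in> indeps M"
  shows "X \<subseteq> ground M"
  using assms by (auto simp: matroid_def)

lemma finite_indep:
  assumes "matroid M" "X \<in> indeps M"
  shows "finite X"
  using finite_subset[OF indep_in_ground[OF assms]] assms(1) by (simp add: matroid_def)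

lemma indep_augment:
  assumes "matroid M" "X \<in> indeps M" "Y \<in> indeps M" "card X < card Y"
  obtains y where "y \<in> Y" "y \<notin> X" "insert y X \<in> indeps M"
proof -
  have "\<exists>y\<in>Y - X. insert y X \<in> indeps M" using assms(1-4) unfolding matroid_def by metis
  then show ?thesis using that by blast
qed

lemma indep_extend:
  assumes M: "matroid M" and Y: "Y \<in> indeps M"
  shows "X \<in> indeps M \<Longrightarrow> card X \<le> card Y \<Longrightarrow>
    \<exists>Z\<in>indeps M. X \<subseteq> Z \<and> Z \<subseteq> X \<union> Y \<and> card Z = card Y"
proof (induction "card Y - card X" arbitrary: X)
  case 0
  then show ?case by (intro bexI[of _ X]) auto
next
  case (Suc k)
  have "card X < card Y" using Suc.hyps(2) by linarith
  then obtain y where y: "y \<in> Y" "y \<notin> X" "insert y X \<in> indeps M"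
    by (rule indep_augment[OF M Suc.prems(1) Y])
  have c: "card (insert y X) = Suc (card X)"
    using y(2) finite_indep[OF M Suc.prems(1)] by simp
  have "k = card Y - card (insert y X)" "card (insert y X) \<le> card Y"
    using Suc.hyps(2) c by linarith+
  then obtain Z where "Z \<in> indeps M" "insert y X \<subseteq> Z" "Z \<subseteq> insert y X \<union> Y" "card Z = card Y"
    using Suc.hyps(1)[OF _ y(3)] by blast
  moreover from this have "X \<subseteq> Z" "Z \<subseteq> X \<union> Y"
    using y(1) by auto
  ultimately show ?case by metis
qed

lemma card_indep_le_maximal_indep:
  assumes M: "matroid M" and B: "B \<in> indeps M" "B \<subseteq> A"
    and max: "\<And>y. y \<in> A - B \<Longrightarrow> insert y B \<notin> indeps M"
    and X: "X \<in> indeps M" "X \<subseteq> A"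
  shows "card X \<le> card B"
proof (rule ccontr)
  assume "\<not> card X \<le> card B"
  then obtain y where "y \<in> X" "y \<notin> B" "insert y B \<in> indeps M"
    using indep_augment[OF M B(1) X(1)] by auto
  then show False using max X(2) by auto
qed

lemma finite_indeps:
  assumes "matroid M"
  shows "finite (indeps M)"
proof (rule finite_subset)
  show "indeps M \<subseteq> Pow (ground M)" "finite (Pow (ground M))"
    using assms by (auto simp: matroid_def)
qed

lemma rank_eqI:
  assumes "matroid M" "B \<in> indeps M" "\<And>X. X \<in> indeps M \<Longrightarrow> card X \<le> card B"
  shows "rank M = card B"
proof -
  have "{X \<in> indeps M. X \<subseteq> ground M} = indeps M"
    using indep_in_ground[OF assms(1)] by auto
  then show ?thesis
    unfolding rank_def rank_of_def
    using assms finite_indeps[OF assms(1)] by (auto intro!: Max_eqI)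
qed

lemma rank_eq_card_basis:
  assumes M: "matroid M" and B: "basis M B"
  shows "rank M = card B"
proof (rule rank_eqI[OF M])
  show I: "B \<in> indeps M" using B by (simp add: basis_def)
  fix X assume X: "X \<in> indeps M"
  show "card X \<le> card B"
  proof (rule card_indep_le_maximal_indep[OF M I indep_in_ground[OF M I] _ X indep_in_ground[OF M X]])
    fix y assume "y \<in> ground M - B"
    then have "insert y B \<noteq> B" by auto
    then show "insert y B \<notin> indeps M" using B subset_insertI unfolding basis_def by metis
  qed
qed

lemma exists_rank_indep:
  assumes M: "matroid M"
  obtains B where "B \<in> indeps M" "card B = rank M" "\<And>X. X \<in> indeps M \<Longrightarrow> card X \<le> rank M"
proof -
  have *: "\<forall>X. X \<in> indeps M \<longrightarrow> card X \<le> card (ground M)"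
    using M indep_in_ground[OF M] by (simp add: matroid_def card_mono)
  have "{} \<in> indeps M" using M by (simp add: matroid_def)
  then obtain B where B: "B \<in> indeps M" "\<forall>X. X \<in> indeps M \<longrightarrow> card X \<le> card B"
    using ex_has_greatest_nat[of "\<lambda>X. X \<in> indeps M" "{}" card "Suc (card (ground M))"] *
    by (auto simp: less_Suc_eq_le)
  then have "rank M = card B" using rank_eqI[OF M] by metis
  then show ?thesis using B that by metis
qed

lemma corank_two_card:
  assumes "corank M = 2"
  shows "card (ground M) = rank M + 2"
  using assms unfolding corank_def by linarith


section \<open>Staircases\<close>

text \<open>
  For a composition \<open>ps = (p\<^sub>1, \<dots>, p\<^sub>s)\<close> of \<open>n\<close> the corners \<open>(S - 1, n - S - 1)\<close>,
  where \<open>S\<close> runs over the partial sums with \<open>0 < S < n\<close>, all have degree \<open>n - 2\<close>; this is what makes the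
  multicomplex pure. The minimal monomials outside it have the degrees \<open>n - p\<^sub>j\<close>, and
  consecutive ones have least common multiple of degree \<open>n\<close>.
\<close>

definition staircase :: "nat list \<Rightarrow> (nat \<times> nat) set" where
  "staircase ps =
     {(u, v). \<exists>j. u < sum_list (take j ps) \<and> v < sum_list (drop j ps)}"

lemma staircase_degree:
  assumes "(u, v) \<in> staircase ps"
  shows "u + v + 2 \<le> sum_list ps"
proof -
  obtain j where "u < sum_list (take j ps)" "v < sum_list (drop j ps)"
    using assms by (auto simp: staircase_def)
  moreover have "sum_list (take j ps) + sum_list (drop j ps) = sum_list ps"
    by (metis append_take_drop_id sum_list_append)
  ultimately show ?thesis by linarith
qed

lemma finite_staircase: "finite (staircase ps)"
proof (rule finite_subset)
  show "staircase ps \<subseteq> {..<sum_list ps} \<times> {..<sum_list ps}"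
    using staircase_degree by fastforce
qed simp

text \<open>
  The columns \<open>u < p\<close> all have the full height \<open>sum_list ps\<close>, since the corner after the first
  block of the composition is the highest one.
\<close>

lemma staircase_Cons:
  "staircase (p # ps) =
     {..<p} \<times> {..<sum_list ps} \<union> (\<lambda>(u, v). (p + u, v)) ` staircase ps"
proof (intro set_eqI iffI)
  fix z assume z: "z \<in> staircase (p # ps)"
  obtain u v where uv: "z = (u, v)" by (cases z)
  obtain j where j: "u < sum_list (take j (p # ps))" "v < sum_list (drop j (p # ps))"
    using z uv by (auto simp: staircase_def)
  then obtain i where i: "j = Suc i" by (cases j) auto
  have "sum_list (take i ps) + sum_list (drop i ps) = sum_list ps"
    by (metis append_take_drop_id sum_list_append)
  then have v: "v < sum_list ps" using j i by simp
  show "z \<in> {..<p} \<times> {..<sum_list ps} \<union> (\<lambda>(u, v). (p + u, v)) ` staircase ps"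
  proof (cases "u < p")
    case True
    then show ?thesis using v uv by simp
  next
    case False
    then have "u - p < sum_list (take i ps)" "v < sum_list (drop i ps)" using j i by auto
    then have "(u - p, v) \<in> staircase ps" by (auto simp: staircase_def)
    then show ?thesis using False uv by (intro UnI2 image_eqI[of _ _ "(u - p, v)"]) auto
  qed
next
  fix z assume "z \<in> {..<p} \<times> {..<sum_list ps} \<union> (\<lambda>(u, v). (p + u, v)) ` staircase ps"
  then show "z \<in> staircase (p # ps)"
  proof
    assume "z \<in> {..<p} \<times> {..<sum_list ps}"
    then show ?thesis by (auto simp: staircase_def intro!: exI[of _ 1])
  next
    assume "z \<in> (\<lambda>(u, v). (p + u, v)) ` staircase ps"
    then obtain u v j where "z = (p + u, v)" "u < sum_list (take j ps)" "v < sum_list (drop j ps)"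
      by (auto simp: staircase_def)
    then show ?thesis by (auto simp: staircase_def intro!: exI[of _ "Suc j"])
  qed
qed

text \<open>
  Counting from the opposite corner, a rectangle contributes a product of two geometric sums.
\<close>

lemma rectangle_generating_function:
  fixes x :: "'b::comm_ring_1"
  shows "(x - 1)^2 * (\<Sum>(u, v)\<in>{..<p} \<times> {..<q}. x ^ (p + q - 2 - (u + v)))
    = (x ^ p - 1) * (x ^ q - 1)"
proof -
  have geo: "(x - 1) * (\<Sum>u<m. x ^ (m - Suc u)) = x ^ m - 1" for m
    by (subst sum.nat_diff_reindex) (simp add: power_diff_1_eq)
  have "(\<Sum>(u, v)\<in>{..<p} \<times> {..<q}. x ^ (p + q - 2 - (u + v)))
      = (\<Sum>(u, v)\<in>{..<p} \<times> {..<q}. x ^ (p - Suc u) * x ^ (q - Suc v))"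
  proof (rule sum.cong[OF refl], clarify)
    fix u v assume "u < p" "v < q"
    then have "p + q - 2 - (u + v) = (p - Suc u) + (q - Suc v)" by simp
    then show "x ^ (p + q - 2 - (u + v)) = x ^ (p - Suc u) * x ^ (q - Suc v)"
      by (simp add: power_add)
  qed
  also have "\<dots> = (\<Sum>u<p. x ^ (p - Suc u)) * (\<Sum>v<q. x ^ (q - Suc v))"
    by (simp add: sum_product sum.cartesian_product)
  finally have "(x - 1)^2 * (\<Sum>(u, v)\<in>{..<p} \<times> {..<q}. x ^ (p + q - 2 - (u + v)))
      = ((x - 1) * (\<Sum>u<p. x ^ (p - Suc u))) * ((x - 1) * (\<Sum>v<q. x ^ (q - Suc v)))"
    by (simp add: power2_eq_square ac_simps)
  then show ?thesis by (simp only: geo)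
qed

text \<open>
  Cutting the staircase into rectangles over the blocks of \<open>ps\<close> gives a sum of terms
  \<open>(x\<^sup>p - 1)(x\<^sup>q - 1)\<close>, where \<open>q\<close> is the sum of the blocks after \<open>p\<close>; this sum telescopes.
\<close>

lemma staircase_generating_function:
  fixes x :: "'b::comm_ring_1"
  shows "(x - 1)^2 * (\<Sum>(u, v)\<in>staircase ps. x ^ (sum_list ps - 2 - (u + v)))
    = x ^ sum_list ps - (\<Sum>p\<leftarrow>ps. x ^ p) + of_nat (length ps) - 1"
proof (induction ps)
  case Nil
  have "staircase [] = {}" by (simp add: staircase_def)
  then show ?case by simp
next
  case (Cons p ps)
  let ?q = "sum_list ps"
  let ?w = "\<lambda>(u, v). x ^ (p + ?q - 2 - (u + v))"
  have inj: "inj_on (\<lambda>(u, v). (p + u, v :: nat)) (staircase ps)" by (auto simp: inj_on_def)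
  have "sum ?w ((\<lambda>(u, v). (p + u, v)) ` staircase ps)
      = (\<Sum>(u, v)\<in>staircase ps. x ^ (?q - 2 - (u + v)))"
    unfolding sum.reindex[OF inj]
  proof (rule sum.cong[OF refl])
    fix z assume z: "z \<in> staircase ps"
    obtain u v where uv: "z = (u, v)" by (cases z)
    have "p + ?q - 2 - (p + u + v) = ?q - 2 - (u + v)"
      using staircase_degree z uv by fastforce
    then show "(?w \<circ> (\<lambda>(u, v). (p + u, v))) z = (case z of (u, v) \<Rightarrow> x ^ (?q - 2 - (u + v)))"
      using uv by simp
  qed
  moreover have "sum ?w (staircase (p # ps))
      = sum ?w ({..<p} \<times> {..<?q}) + sum ?w ((\<lambda>(u, v). (p + u, v)) ` staircase ps)"
    unfolding staircase_Cons by (rule sum.union_disjoint) (auto simp: finite_staircase)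
  ultimately have "(x - 1)^2 * sum ?w (staircase (p # ps))
      = (x ^ p - 1) * (x ^ ?q - 1)
        + (x - 1)^2 * (\<Sum>(u, v)\<in>staircase ps. x ^ (?q - 2 - (u + v)))"
    using rectangle_generating_function[of x p ?q] by (simp add: distrib_left)
  then have "(x - 1)^2 * sum ?w (staircase (p # ps))
      = (x ^ p - 1) * (x ^ ?q - 1) + (x ^ ?q - (\<Sum>p\<leftarrow>ps. x ^ p) + of_nat (length ps) - 1)"
    unfolding Cons.IH .
  also have "\<dots> = x ^ (p + ?q) - (x ^ p + (\<Sum>p\<leftarrow>ps. x ^ p)) + (1 + of_nat (length ps)) - 1"
    by (simp add: power_add left_diff_distrib right_diff_distrib)
  finally show ?case by simp
qed

text \<open>
  Every monomial of the staircase divides a corner, so the maximal ones are corners, which all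
  have the same degree. The two variables are indexed by an arbitrary pair, because the same
  multicomplex is needed both on \<open>R\<close> and on \<open>{0, 1}\<close>.
\<close>

lemma staircase_pure_multicomplex:
  fixes i j :: 'v and ps :: "nat list"
  assumes ij: "i \<noteq> j"
  defines "F \<equiv> {a \<in> exponents {i, j}. (a i, a j) \<in> staircase ps}"
  shows "pure_multicomplex {i, j} F"
    and "degree_sequence {i, j} F = (\<lambda>k. int (card {(u, v) \<in> staircase ps. u + v = k}))"
proof -
  define f where "f = (\<lambda>(u, v). (\<lambda>_. 0 :: nat)(i := u, j := v))"
  have f: "a = f (a i, a j)" if "a \<in> exponents {i, j}" for a
    using that by (auto simp: f_def exponents_def)
  have f': "f z \<in> exponents {i, j}" "f z i = fst z" "f z j = snd z" for z
    using ij by (auto simp: f_def exponents_def split: prod.splits)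
  have F: "F = f ` staircase ps"
  proof (intro set_eqI iffI)
    fix a assume "a \<in> F"
    then show "a \<in> f ` staircase ps" using f[of a] by (auto simp: F_def)
  next
    fix a assume "a \<in> f ` staircase ps"
    then show "a \<in> F" using f' by (auto simp: F_def)
  qed
  have deg: "sum a {i, j} = a i + a j" for a :: "'v \<Rightarrow> nat"
    using ij by simp
  have top: "sum a {i, j} = sum_list ps - 2" if a: "maximal_in F a" for a
  proof -
    obtain k where k: "a i < sum_list (take k ps)" "a j < sum_list (drop k ps)"
      using a by (auto simp: maximal_in_def F_def staircase_def)
    have s: "sum_list (take k ps) + sum_list (drop k ps) = sum_list ps"
      by (metis append_take_drop_id sum_list_append)
    define b where "b = f (sum_list (take k ps) - 1, sum_list (drop k ps) - 1)"
    have "b \<in> F" unfolding F b_def using k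
      by (intro imageI) (auto simp: staircase_def intro!: exI[of _ k])
    moreover have "a \<le> b"
    proof (rule le_funI)
      fix e
      have "a e = 0" if "e \<noteq> i" "e \<noteq> j"
        using that a by (auto simp: maximal_in_def F_def exponents_def)
      then show "a e \<le> b e" using k by (cases "e = i"; cases "e = j") (auto simp: b_def f_def)
    qed
    ultimately have "b = a" using a by (auto simp: maximal_in_def)
    then have "a i = sum_list (take k ps) - 1" "a j = sum_list (drop k ps) - 1"
      by (auto simp: b_def f')
    then show ?thesis using k s deg by simp
  qed
  have down: "b \<in> F" if "a \<in> F" "b \<le> a" for a b
  proof -
    have le: "b e \<le> a e" for e using that(2) by (simp add: le_fun_def)
    have "b \<in> exponents {i, j}"
      using that(1) le by (auto simp: F_def exponents_def) (metis le_zero_eq)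
    moreover have "(b i, b j) \<in> staircase ps"
      using that(1) le_less_trans[OF le[of i]] le_less_trans[OF le[of j]]
      by (auto simp: F_def staircase_def)
    ultimately show ?thesis by (simp add: F_def)
  qed
  have "finite F" unfolding F by (simp add: finite_staircase)
  moreover have "F \<subseteq> exponents {i, j}" by (auto simp: F_def)
  ultimately show "pure_multicomplex {i, j} F"
    unfolding pure_multicomplex_def multicomplex_def using down top by metis
  have "card {a \<in> F. sum a {i, j} = k} = card {(u, v) \<in> staircase ps. u + v = k}" for k
  proof -
    have "{a \<in> F. sum a {i, j} = k} = f ` {(u, v) \<in> staircase ps. u + v = k}"
      unfolding F using f' deg by auto
    moreover have "inj f" by (rule injI) (metis f'(2,3) prod.expand)
    ultimately show ?thesis by (simp add: card_image inj_on_subset)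
  qed
  then show "degree_sequence {i, j} F = (\<lambda>k. int (card {(u, v) \<in> staircase ps. u + v = k}))"
    by (simp add: degree_sequence_def fun_eq_iff)
qed


section \<open>The h-vector in corank two\<close>

text \<open>
  Here \<open>r\<close> is the parallelism relation of the dual matroid, of rank two, and \<open>S\<close> the set of its
  non-loops: \<open>e\<close> and \<open>f\<close> are related unless \<open>E - {e, f}\<close> is a basis. Transitivity comes from one
  augmentation: if \<open>E - {e, g}\<close> is a basis and the non-loop \<open>f\<close> is avoided by a basis
  \<open>E - {f, h}\<close>, then the latter extends \<open>E - {e, f, g}\<close> by \<open>e\<close> or by \<open>g\<close>.
\<close>

lemma corank_two_parallel_classes:
  assumes M: "matroid M" and cr: "corank M = 2"
  obtains S r where "S \<subseteq> ground M" "equiv S r"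
    "\<And>A. A \<subseteq> ground M \<Longrightarrow> A \<in> indeps M \<longleftrightarrow> (\<exists>e\<in>S - A. \<exists>f\<in>S - A. (e, f) \<notin> r)"
proof -
  let ?E = "ground M"
  have fin: "finite ?E" using M by (simp add: matroid_def)
  have n: "card ?E = rank M + 2" by (rule corank_two_card[OF cr])
  define adj where "adj e f \<longleftrightarrow> e \<in> ?E \<and> f \<in> ?E \<and> e \<noteq> f \<and> ?E - {e, f} \<in> indeps M" for e f
  define S where "S = {e. \<exists>f. adj e f}"
  define r where "r = {(e, f). e \<in> S \<and> f \<in> S \<and> \<not> adj e f}"
  have sym: "adj f e" if "adj e f" for e f using that by (auto simp: adj_def insert_commute)
  have card_adj: "card (?E - {e, f}) = rank M" if "adj e f" for e f
    using that n fin by (auto simp: adj_def card_Diff_subset)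
  have exchange: "adj e f \<or> adj g f" if eg: "adj e g" and f: "f \<in> S" for e f g
  proof (cases "f = e \<or> f = g")
    case True
    then show ?thesis using eg sym by auto
  next
    case False
    obtain h where h: "adj f h" using f by (auto simp: S_def)
    let ?X = "?E - {e, g} - {f}"
    have X: "?X \<in> indeps M" using eg indep_subset[OF M] by (auto simp: adj_def)
    have "f \<in> ?E - {e, g}" using False h by (auto simp: adj_def)
    then have "card ?X < card (?E - {e, g})" using fin by (intro card_Diff1_less) auto
    then have "card ?X < card (?E - {f, h})" using card_adj[OF eg] card_adj[OF h] by simp
    then obtain y where y: "y \<in> ?E - {f, h}" "y \<notin> ?X" "insert y ?X \<in> indeps M"
      using indep_augment[OF M X, of "?E - {f, h}"] h by (auto simp: adj_def)
    consider "y = e" | "y = g" using y by auto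
    then show ?thesis
    proof cases
      case 1
      then have "insert y ?X = ?E - {g, f}" using False eg by (auto simp: adj_def)
      then show ?thesis using y(3) h eg False by (auto simp: adj_def)
    next
      case 2
      then have "insert y ?X = ?E - {e, f}" using False eg by (auto simp: adj_def)
      then show ?thesis using y(3) h eg False by (auto simp: adj_def)
    qed
  qed
  show ?thesis
  proof (rule that)
    show "S \<subseteq> ?E" by (auto simp: S_def adj_def)
    show "equiv S r"
    proof (rule equivI)
      show "r \<subseteq> S \<times> S" by (auto simp: r_def)
      show "refl_on S r" by (auto simp: refl_on_def r_def adj_def)
      show "sym r" using sym by (auto simp: sym_def r_def)
      show "trans r" using exchange sym unfolding trans_def r_def by blast
    qed
    fix A assume A: "A \<subseteq> ?E"
    have "A \<in> indeps M \<longleftrightarrow> (\<exists>e f. adj e f \<and> e \<notin> A \<and> f \<notin> A)"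
    proof
      assume AI: "A \<in> indeps M"
      obtain B where B: "B \<in> indeps M" "card B = rank M"
        and le: "\<And>X. X \<in> indeps M \<Longrightarrow> card X \<le> rank M"
        using exists_rank_indep[OF M] by blast
      obtain Z where Z: "Z \<in> indeps M" "A \<subseteq> Z" "card Z = card B"
        using indep_extend[OF M B(1) AI] le[OF AI] B(2) by auto
      have ZE: "Z \<subseteq> ?E" using indep_in_ground[OF M Z(1)] .
      have "card (?E - Z) = 2"
        using card_Diff_subset[OF finite_indep[OF M Z(1)] ZE] Z(3) B(2) n by simp
      then obtain e f where ef: "?E - Z = {e, f}" "e \<noteq> f" by (auto simp: card_2_iff)
      then have "?E - {e, f} = Z" using ZE by auto
      then have "adj e f" using Z(1) ef by (auto simp: adj_def)
      then show "\<exists>e f. adj e f \<and> e \<notin> A \<and> f \<notin> A" using ef Z(2) by blast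
    next
      assume "\<exists>e f. adj e f \<and> e \<notin> A \<and> f \<notin> A"
      then obtain e f where "adj e f" "e \<notin> A" "f \<notin> A" by blast
      then show "A \<in> indeps M"
        using A indep_subset[OF M, of "?E - {e, f}" A] by (auto simp: adj_def)
    qed
    also have "\<dots> \<longleftrightarrow> (\<exists>e\<in>S - A. \<exists>f\<in>S - A. (e, f) \<notin> r)"
      using sym by (auto simp: S_def r_def)
    finally show "A \<in> indeps M \<longleftrightarrow> (\<exists>e\<in>S - A. \<exists>f\<in>S - A. (e, f) \<notin> r)" .
  qed
qed

lemma sum_power_card_Pow:
  fixes x :: "'b::comm_ring_1"
  assumes "finite A"
  shows "(\<Sum>D\<in>Pow A. (x - 1) ^ card D) = x ^ card A"
  using prod_add[OF assms, of "\<lambda>_. x - 1" "\<lambda>_. 1"] by simp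

text \<open>
  A set meeting at most one class either lies in \<open>E - S\<close>, or lies in \<open>E - S\<close> together with one
  class \<open>C\<close>, but not in \<open>E - S\<close>; the class is then unique.
\<close>

lemma sum_power_card_within_class:
  fixes x :: "'b::comm_ring_1"
  assumes fin: "finite E" and S: "S \<subseteq> E" and r: "equiv S r"
  shows "(\<Sum>D | D \<subseteq> E \<and> (\<forall>e\<in>D \<inter> S. \<forall>f\<in>D \<inter> S. (e, f) \<in> r). (x - 1) ^ card D)
    = x ^ card (E - S) * (1 + (\<Sum>C\<in>S // r. x ^ card C - 1))"
proof -
  let ?w = "\<lambda>D. (x - 1) ^ card D"
  let ?L = "E - S"
  define G where "G C = Pow (?L \<union> C) - Pow ?L" for C
  have finS: "finite S" using fin S finite_subset by blast
  have finQ: "finite (S // r)" using finS r equiv_type by (intro finite_quotient) auto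
  have CS: "C \<subseteq> S" if "C \<in> S // r" for C using in_quotient_imp_subset[OF r that] .
  have finC: "finite C" if "C \<in> S // r" for C using CS[OF that] finS finite_subset by blast
  have finG: "finite (G C)" if "C \<in> S // r" for C using finC[OF that] fin by (simp add: G_def)
  have decomp: "{D. D \<subseteq> E \<and> (\<forall>e\<in>D \<inter> S. \<forall>f\<in>D \<inter> S. (e, f) \<in> r)}
      = Pow ?L \<union> (\<Union>C\<in>S // r. G C)" (is "?D = ?U")
  proof (intro set_eqI iffI)
    fix D assume D: "D \<in> ?D"
    show "D \<in> ?U"
    proof (cases "D \<subseteq> ?L")
      case False
      then obtain e where e: "e \<in> D" "e \<in> S" using D by auto
      have "D \<subseteq> ?L \<union> r `` {e}" using D e by auto
      then show ?thesis using False e by (auto simp: G_def intro: quotientI)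
    qed simp
  next
    fix D assume "D \<in> ?U"
    then show "D \<in> ?D"
    proof
      assume "D \<in> (\<Union>C\<in>S // r. G C)"
      then obtain C where C: "C \<in> S // r" "D \<subseteq> ?L \<union> C" by (auto simp: G_def)
      have "(e, f) \<in> r" if "e \<in> D \<inter> S" "f \<in> D \<inter> S" for e f
        using in_quotient_imp_in_rel[OF r C(1)] C(2) that by blast
      then show ?thesis using C CS[OF C(1)] S by auto
    qed auto
  qed
  have disj: "G C \<inter> G C' = {}" if "C \<in> S // r" "C' \<in> S // r" "C \<noteq> C'" for C C'
    using quotient_disj[OF r that(1,2)] that(3) by (auto simp: G_def)
  have sumG: "sum ?w (G C) = x ^ card ?L * (x ^ card C - 1)" if C: "C \<in> S // r" for C
  proof -
    have "sum ?w (G C) = sum ?w (Pow (?L \<union> C)) - sum ?w (Pow ?L)"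
      unfolding G_def using fin finC[OF C] by (intro sum_diff) auto
    also have "\<dots> = x ^ card (?L \<union> C) - x ^ card ?L"
      using fin finC[OF C] by (simp add: sum_power_card_Pow del: Pow_iff)
    also have "card (?L \<union> C) = card ?L + card C"
      using fin finC[OF C] CS[OF C] by (intro card_Un_disjoint) auto
    finally show ?thesis by (simp add: power_add algebra_simps)
  qed
  have "sum ?w ?D = sum ?w (Pow ?L) + sum ?w (\<Union>C\<in>S // r. G C)"
    unfolding decomp using fin finQ finG
    by (intro sum.union_disjoint) (auto simp: G_def)
  also have "sum ?w (\<Union>C\<in>S // r. G C) = (\<Sum>C\<in>S // r. sum ?w (G C))"
    using finQ finG disj by (intro sum.UNION_disjoint) auto
  finally show ?thesis
    using fin by (simp add: sum_power_card_Pow sumG sum_distrib_left distrib_left)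
qed

text \<open>
  Independent sets are the sets whose complement meets two classes, so the sum over them is the
  sum over all complements minus that over complements meeting at most one class. The right-hand
  side is, up to the factor for the coloops of \<open>M\<close>, the numerator of a staircase on the class
  sizes, in any order.
\<close>

lemma corank_two_sum_indeps:
  fixes x :: "'b::comm_ring_1"
  assumes M: "matroid M" and cr: "corank M = 2"
  obtains ps where "sum_list ps \<le> card (ground M)"
    "(\<Sum>A\<in>indeps M. (x - 1) ^ card (ground M - A))
      = x ^ (card (ground M) - sum_list ps)
        * (x ^ sum_list ps - (\<Sum>p\<leftarrow>ps. x ^ p) + of_nat (length ps) - 1)"
proof -
  let ?E = "ground M"
  have fin: "finite ?E" using M by (simp add: matroid_def)
  obtain S r where S: "S \<subseteq> ?E" and r: "equiv S r"
    and ind: "\<And>A. A \<subseteq> ?E \<Longrightarrow> A \<in> indeps M \<longleftrightarrow> (\<exists>e\<in>S - A. \<exists>f\<in>S - A. (e, f) \<notin> r)"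
    using corank_two_parallel_classes[OF M cr] by blast
  have finS: "finite S" using fin S finite_subset by blast
  have finQ: "finite (S // r)" using finS r equiv_type by (intro finite_quotient) auto
  obtain cs where cs: "set cs = S // r" "distinct cs"
    using finite_distinct_list[OF finQ] by blast
  define ps where "ps = map card cs"
  have cardS: "card S = sum_list ps"
  proof -
    have "card (\<Union>(S // r)) = (\<Sum>C\<in>S // r. card C)"
    proof (rule card_Union_disjoint)
      show "pairwise disjnt (S // r)"
        using quotient_disj[OF r] by (auto simp: pairwise_def disjnt_def)
      show "finite C" if "C \<in> S // r" for C
        using in_quotient_imp_subset[OF r that] finS by (rule finite_subset)
    qed
    then show ?thesis
      using Union_quotient[OF r] cs by (simp add: ps_def sum_list_distinct_conv_sum_set)
  qed
  have cardL: "card (?E - S) = card ?E - sum_list ps"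
    using card_Diff_subset[OF finS S] cardS by simp
  have le: "sum_list ps \<le> card ?E" using cardS card_mono[OF fin S] by simp
  have classes: "(\<Sum>C\<in>S // r. x ^ card C - 1) = (\<Sum>p\<leftarrow>ps. x ^ p) - of_nat (length ps)"
  proof -
    have "(\<Sum>C\<in>S // r. x ^ card C - 1) = (\<Sum>C\<in>S // r. x ^ card C) - of_nat (card (S // r))"
      by (simp add: sum_subtractf)
    then show ?thesis
      using cs distinct_card[OF cs(2)]
      by (simp add: ps_def sum_list_distinct_conv_sum_set o_def)
  qed
  let ?D = "{D. D \<subseteq> ?E \<and> (\<forall>e\<in>D \<inter> S. \<forall>f\<in>D \<inter> S. (e, f) \<in> r)}"
  let ?w = "\<lambda>D. (x - 1) ^ card D"
  have "(\<Sum>A\<in>indeps M. (x - 1) ^ card (?E - A)) = sum ?w (Pow ?E - ?D)"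
  proof (rule sum.reindex_bij_witness[of _ "\<lambda>D. ?E - D" "\<lambda>A. ?E - A"])
    fix A assume A: "A \<in> indeps M"
    then have AE: "A \<subseteq> ?E" using indep_in_ground[OF M] by blast
    then show "?E - (?E - A) = A" by auto
    show "?E - A \<in> Pow ?E - ?D" using ind[OF AE] A S by auto
  next
    fix D assume D: "D \<in> Pow ?E - ?D"
    then show "?E - (?E - D) = D" by auto
    show "?E - D \<in> indeps M" using D ind[of "?E - D"] S by auto
  qed simp
  also have "\<dots> = sum ?w (Pow ?E) - sum ?w ?D"
    using fin by (intro sum_diff) auto
  also have "\<dots> = x ^ card ?E
      - x ^ (card ?E - sum_list ps) * (1 + ((\<Sum>p\<leftarrow>ps. x ^ p) - of_nat (length ps)))"
    using sum_power_card_Pow[OF fin, of x] sum_power_card_within_class[OF fin S r, of x]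
    by (simp only: cardL classes)
  also have "x ^ card ?E = x ^ (card ?E - sum_list ps) * x ^ sum_list ps"
    using le by (simp flip: power_add)
  also have "x ^ (card ?E - sum_list ps) * x ^ sum_list ps
      - x ^ (card ?E - sum_list ps) * (1 + ((\<Sum>p\<leftarrow>ps. x ^ p) - of_nat (length ps)))
      = x ^ (card ?E - sum_list ps)
        * (x ^ sum_list ps - (\<Sum>p\<leftarrow>ps. x ^ p) + of_nat (length ps) - 1)"
    unfolding right_diff_distrib[symmetric] by (rule arg_cong[where f = "(*) _"]) simp
  finally show ?thesis by (rule that[OF le])
qed

text \<open>
  The polynomials of \<open>M\<close> and of the staircase agree after multiplication by \<open>(x - 1)\<^sup>2\<close>, which
  can be cancelled in \<open>\<int>[x]\<close>. The coloops of \<open>M\<close> contribute a power of \<open>x\<close>, which replaces the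
  top degree of the staircase by the rank of \<open>M\<close>.
\<close>

lemma h_vector_corank_two:
  assumes M: "matroid M" and cr: "corank M = 2"
  obtains ps where "h_vector M = (\<lambda>k. int (card {(u, v) \<in> staircase ps. u + v = k}))"
proof -
  let ?E = "ground M"
  define X :: "int poly" where "X = [:0, 1:]"
  have X1: "[:-1, 1:] = X - 1" by (simp add: X_def one_pCons)
  have X0: "X - 1 \<noteq> 0" by (simp flip: X1)
  have fin: "finite ?E" using M by (simp add: matroid_def)
  have n: "card ?E = rank M + 2" by (rule corank_two_card[OF cr])
  have le: "card A \<le> rank M" if "A \<in> indeps M" for A
    using exists_rank_indep[OF M] that by metis
  obtain ps where ps: "sum_list ps \<le> card ?E"
    and sum: "(\<Sum>A\<in>indeps M. (X - 1) ^ card (?E - A))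
      = X ^ (card ?E - sum_list ps)
        * (X ^ sum_list ps - (\<Sum>p\<leftarrow>ps. X ^ p) + of_nat (length ps) - 1)"
    using corank_two_sum_indeps[OF M cr] by blast
  have "(X - 1)^2 * poly (tutte M) 1 = (\<Sum>A\<in>indeps M. (X - 1) ^ card (?E - A))"
    unfolding tutte_at_1[OF M] X1 sum_distrib_left
  proof (rule sum.cong[OF refl])
    fix A assume A: "A \<in> indeps M"
    have "card (?E - A) = 2 + (rank M - card A)"
      using card_Diff_subset[OF finite_indep[OF M A] indep_in_ground[OF M A]] n le[OF A] by simp
    then show "(X - 1)^2 * (X - 1) ^ (rank M - card A) = (X - 1) ^ card (?E - A)"
      by (simp only: power_add)
  qed
  also have "\<dots> = X ^ (card ?E - sum_list ps)
      * ((X - 1)^2 * (\<Sum>(u, v)\<in>staircase ps. X ^ (sum_list ps - 2 - (u + v))))"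
    using sum staircase_generating_function[of X ps] by simp
  also have "\<dots> = (X - 1)^2 * (\<Sum>(u, v)\<in>staircase ps.
      X ^ (card ?E - sum_list ps) * X ^ (sum_list ps - 2 - (u + v)))"
    by (simp add: sum_distrib_left case_prod_unfold mult.left_commute)
  also have "(\<Sum>(u, v)\<in>staircase ps.
      X ^ (card ?E - sum_list ps) * X ^ (sum_list ps - 2 - (u + v)))
      = (\<Sum>(u, v)\<in>staircase ps. X ^ (rank M - (u + v)))"
  proof (rule sum.cong[OF refl], clarify)
    fix u v assume "(u, v) \<in> staircase ps"
    from staircase_degree[OF this]
    have "rank M - (u + v) = (card ?E - sum_list ps) + (sum_list ps - 2 - (u + v))"
      using ps n by linarith
    then show "X ^ (card ?E - sum_list ps) * X ^ (sum_list ps - 2 - (u + v))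
        = X ^ (rank M - (u + v))"
      by (simp add: power_add)
  qed
  finally have T: "poly (tutte M) 1 = (\<Sum>(u, v)\<in>staircase ps. X ^ (rank M - (u + v)))"
    using X0 by simp
  have deg: "u + v \<le> rank M" if "(u, v) \<in> staircase ps" for u v
    using staircase_degree[OF that] ps n by linarith
  have X_coeff: "coeff (X ^ m) l = (if l = m then 1 else 0)" for m l
  proof -
    have "X ^ m = monom 1 m" by (simp add: X_def monom_altdef)
    then show ?thesis by auto
  qed
  have "h_vector M k = int (card {(u, v) \<in> staircase ps. u + v = k})" for k
  proof (cases "k \<le> rank M")
    case True
    have "h_vector M k
        = (\<Sum>z\<in>staircase ps. if rank M - k = rank M - (fst z + snd z) then 1 else 0)"
      using True by (simp add: h_vector_def T coeff_sum case_prod_unfold X_coeff)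
    also have "\<dots> = (\<Sum>z\<in>staircase ps. if fst z + snd z = k then 1 else 0)"
      using deg True by (intro sum.cong) fastforce+
    also have "\<dots> = int (card {z \<in> staircase ps. fst z + snd z = k})"
      using finite_staircase by (simp add: sum.If_cases Int_def)
    finally show ?thesis by (simp add: case_prod_unfold)
  next
    case False
    then have empty: "{(u, v) \<in> staircase ps. u + v = k} = {}" using deg by auto
    show ?thesis unfolding empty using False by (simp add: h_vector_def)
  qed
  then show ?thesis by (intro that[of ps]) auto
qed

lemma corank_two_pure_multicomplex:
  assumes "matroid M" "corank M = 2" "card R = 2"
  shows "\<exists>F. pure_multicomplex R F \<and> degree_sequence R F = h_vector M"
proof -
  obtain i j where R: "R = {i, j}" "i \<noteq> j" using assms(3) by (auto simp: card_2_iff)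
  obtain ps where "h_vector M = (\<lambda>k. int (card {(u, v) \<in> staircase ps. u + v = k}))"
    using h_vector_corank_two[OF assms(1,2)] by blast
  then show ?thesis using staircase_pure_multicomplex[OF R(2), of ps] R(1) by auto
qed


section \<open>Strata and the dead node\<close>

lemma fund_circuit:
  assumes "matroid M" "basis M B" "i \<in> ground M - B"
  shows "circuit M (fund_circuit M B i)" "fund_circuit M B i \<subseteq> insert i B"
    "i \<in> fund_circuit M B i"
proof -
  show c: "circuit M (fund_circuit M B i)" and s: "fund_circuit M B i \<subseteq> insert i B"
    using theI'[OF fund_circuit_unique[OF assms]] by (auto simp: fund_circuit_def)
  have "B \<in> indeps M" using assms(2) by (simp add: basis_def)
  then have "\<not> fund_circuit M B i \<subseteq> B"
    using c indep_subset[OF assms(1)] by (auto simp: circuit_def)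
  then show "i \<in> fund_circuit M B i" using s by blast
qed

lemma covered_once_singleton:
  assumes "matroid M" "basis M B" "i \<in> ground M - B"
  shows "covered_once M B {i} = fund_circuit M B i"
proof -
  have "cover_mult M B {i} e = (if e \<in> fund_circuit M B i then 1 else 0)" for e
    by (simp add: cover_mult_def conj_commute cong: conj_cong)
  then show ?thesis
    using fund_circuit(1)[OF assms] by (auto simp: covered_once_def circuit_def)
qed

lemma baseline_singleton:
  assumes "matroid M" "basis M B" "i \<in> ground M - B"
  shows "baseline M B {i} i = card (fund_circuit M B i)"
  using covered_once_singleton[OF assms] by (simp add: baseline_def)

lemma singleton_live:
  assumes "matroid M" "basis M B" "i \<in> ground M - B"
  shows "\<not> dead M B {i}"
  using covered_once_singleton[OF assms] fund_circuit(1)[OF assms]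
  by (simp add: dead_def circuit_def)

lemma covered_pair:
  assumes "matroid M" "basis M B" "i \<in> ground M - B" "j \<in> ground M - B" "i \<noteq> j"
  shows "covered M B {i, j} = fund_circuit M B i \<union> fund_circuit M B j"
    "covered_once M B {i, j} = sym_diff (fund_circuit M B i) (fund_circuit M B j)"
proof -
  let ?C = "fund_circuit M B i" and ?D = "fund_circuit M B j"
  have mult: "cover_mult M B {i, j} e = (if e \<in> ?C then 1 else 0) + (if e \<in> ?D then 1 else 0)"
    for e
  proof -
    have "{k \<in> {i, j}. e \<in> fund_circuit M B k}
        = (if e \<in> ?C then {i} else {}) \<union> (if e \<in> ?D then {j} else {})" by auto
    then show ?thesis using assms(5) by (simp add: cover_mult_def)
  qed
  have "?C \<subseteq> ground M" "?D \<subseteq> ground M"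
    using fund_circuit(1)[OF assms(1,2)] assms(3,4) unfolding circuit_def by blast+
  then have E: "e \<in> ground M" if "e \<in> ?C \<or> e \<in> ?D" for e using that by blast
  show "covered M B {i, j} = ?C \<union> ?D"
  proof (rule set_eqI)
    show "e \<in> covered M B {i, j} \<longleftrightarrow> e \<in> ?C \<union> ?D" for e
      using E[of e] by (simp add: covered_def mult)
  qed
  show "covered_once M B {i, j} = sym_diff ?C ?D"
  proof (rule set_eqI)
    show "e \<in> covered_once M B {i, j} \<longleftrightarrow> e \<in> sym_diff ?C ?D" for e
      using E[of e] by (simp add: covered_once_def mult)
  qed
qed

text \<open>
  When \<open>U\<close> is independent, it is the only basis of \<open>M|U\<close>, so the contraction of \<open>U\<close> in
  \<open>M|A\<close> is simply the link of \<open>U\<close>.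
\<close>

lemma indeps_contract_restrict:
  assumes M: "matroid M" and U: "U \<in> indeps M" "U \<subseteq> A"
  shows "indeps (contract (restrict M A) U) = {X. X \<subseteq> A - U \<and> X \<union> U \<in> indeps M}"
proof -
  have "basis (restrict (restrict M A) U) I \<longleftrightarrow> I = U" for I
    using U by (auto simp: basis_def restrict_def)
  moreover have "X \<subseteq> ground M" if "X \<union> U \<in> indeps M" for X
    using indep_in_ground[OF M that] by simp
  ultimately show ?thesis
    using U by (auto simp: contract_def restrict_def)
qed

lemma matroid_contract_restrict:
  assumes M: "matroid M" and U: "U \<in> indeps M" "U \<subseteq> A"
  shows "matroid (contract (restrict M A) U)"
  unfolding matroid_def indeps_contract_restrict[OF assms]
proof (intro conjI allI impI)
  show "finite (ground (contract (restrict M A) U))"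
    using M by (simp add: contract_def restrict_def matroid_def)
  show "{X. X \<subseteq> A - U \<and> X \<union> U \<in> indeps M} \<subseteq> Pow (ground (contract (restrict M A) U))"
    using indep_in_ground[OF M] by (fastforce simp: contract_def restrict_def)
  show "{} \<in> {X. X \<subseteq> A - U \<and> X \<union> U \<in> indeps M}" using U by simp
  show "X \<in> {X. X \<subseteq> A - U \<and> X \<union> U \<in> indeps M}"
    if "Y \<in> {X. X \<subseteq> A - U \<and> X \<union> U \<in> indeps M} \<and> X \<subseteq> Y" for X Y
  proof -
    have "Y \<union> U \<in> indeps M" "X \<union> U \<subseteq> Y \<union> U" "X \<subseteq> A - U" using that by auto
    then show ?thesis using indep_subset[OF M] by auto
  qed
  fix X Y
  assume XY: "X \<in> {X. X \<subseteq> A - U \<and> X \<union> U \<in> indeps M}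
    \<and> Y \<in> {X. X \<subseteq> A - U \<and> X \<union> U \<in> indeps M} \<and> card X < card Y"
  have "card (Z \<union> U) = card Z + card U" if "Z \<subseteq> A - U" "Z \<union> U \<in> indeps M" for Z
    using finite_indep[OF M that(2)] that(1) by (intro card_Un_disjoint) auto
  then have "card (X \<union> U) < card (Y \<union> U)" using XY by auto
  then obtain y where "y \<in> Y \<union> U" "y \<notin> X \<union> U" "insert y (X \<union> U) \<in> indeps M"
    using indep_augment[OF M, of "X \<union> U" "Y \<union> U"] XY by blast
  then show "\<exists>y\<in>Y - X. insert y X \<in> {X. X \<subseteq> A - U \<and> X \<union> U \<in> indeps M}"
    using XY by (intro bexI[of _ y]) auto
qed

text \<open>
  The rank of \<open>M|A\<close> is \<open>|A| - 2\<close>, because removing \<open>i\<close> and \<open>j\<close> from \<open>A\<close> leaves a set that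
  is independent and becomes dependent, through a fundamental circuit, when either of them is put
  back. Contracting an independent set preserves corank.
\<close>

lemma corank_dead_node:
  assumes M: "matroid M" and B: "basis M B"
    and i: "i \<in> ground M - B" and j: "j \<in> ground M - B" and ij: "i \<noteq> j"
    and U: "covered_once M B {i, j} \<in> indeps M"
  shows "matroid (dead_node M B {i, j})" "corank (dead_node M B {i, j}) = 2"
    "ground (dead_node M B {i, j}) = fund_circuit M B i \<inter> fund_circuit M B j"
proof -
  let ?C = "fund_circuit M B i" and ?D = "fund_circuit M B j"
  let ?K = "dead_node M B {i, j}"
  define A where "A = ?C \<union> ?D"
  define U' where "U' = sym_diff ?C ?D"
  note c = fund_circuit[OF M B i] and d = fund_circuit[OF M B j]
  have K: "?K = contract (restrict M A) U'"
    by (simp add: dead_node_def covered_pair[OF M B i j ij] A_def U'_def)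
  have UI: "U' \<in> indeps M" "U' \<subseteq> A"
    using U by (auto simp: covered_pair[OF M B i j ij] A_def U'_def)
  have AE: "A \<subseteq> ground M" using c(1) d(1) by (auto simp: A_def circuit_def)
  have finA: "finite A" using AE M finite_subset by (auto simp: matroid_def)
  show mK: "matroid ?K" unfolding K by (rule matroid_contract_restrict[OF M UI])
  have gK: "ground ?K = A - U'" using AE by (auto simp: K contract_def restrict_def)
  then show "ground ?K = ?C \<inter> ?D" by (auto simp: A_def U'_def)
  note iK = indeps_contract_restrict[OF M UI, folded K]
  define A\<^sub>0 where "A\<^sub>0 = A - {i, j}"
  have A0: "A\<^sub>0 \<in> indeps M"
  proof (rule indep_subset[OF M])
    show "B \<in> indeps M" using B by (simp add: basis_def)
    show "A\<^sub>0 \<subseteq> B" using c(2) d(2) by (auto simp: A\<^sub>0_def A_def)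
  qed
  have max: "insert y A\<^sub>0 \<notin> indeps M" if y: "y \<in> A - A\<^sub>0" for y
  proof
    assume I: "insert y A\<^sub>0 \<in> indeps M"
    have "?C \<subseteq> insert y A\<^sub>0 \<or> ?D \<subseteq> insert y A\<^sub>0"
      using y c(2) d(2) i j ij by (auto simp: A\<^sub>0_def A_def)
    then show False using I indep_subset[OF M] c(1) d(1) by (auto simp: circuit_def)
  qed
  have "card X \<le> card A\<^sub>0" if "X \<in> indeps M" "X \<subseteq> A" for X
    by (rule card_indep_le_maximal_indep[OF M A0 _ max that]) (auto simp: A\<^sub>0_def)
  note le = this
  have cA: "card A = card A\<^sub>0 + 2"
  proof -
    have ij_A: "{i, j} \<subseteq> A" using c(3) d(3) by (auto simp: A_def)
    have "card A\<^sub>0 = card A - card {i, j}"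
      unfolding A\<^sub>0_def by (rule card_Diff_subset[OF _ ij_A]) simp
    moreover have "card {i, j} \<le> card A" by (rule card_mono[OF finA ij_A])
    ultimately show ?thesis using ij by simp
  qed
  have union: "card (X \<union> U') = card X + card U'" if "X \<subseteq> A - U'" for X
    using finA UI(2) that by (intro card_Un_disjoint) (auto intro: finite_subset)
  obtain Z where Z: "Z \<in> indeps M" "U' \<subseteq> Z" "Z \<subseteq> U' \<union> A\<^sub>0" "card Z = card A\<^sub>0"
    using indep_extend[OF M A0 UI(1) le[OF UI]] by blast
  have ZU: "Z - U' \<in> indeps ?K"
    using Z UI(2) by (auto simp: iK A\<^sub>0_def Un_absorb2)
  have cZ: "card (Z - U') + card U' = card A\<^sub>0"
    using union[of "Z - U'"] ZU Z(2,4) by (auto simp: iK Un_absorb2)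
  have "rank ?K = card (Z - U')"
  proof (rule rank_eqI[OF mK ZU])
    fix X assume X: "X \<in> indeps ?K"
    then have "card X + card U' \<le> card A\<^sub>0"
      using union[of X] le[of "X \<union> U'"] UI(2) by (auto simp: iK)
    then show "card X \<le> card (Z - U')" using cZ by linarith
  qed
  moreover have "card (A - U') + card U' = card A"
    using union[of "A - U'"] UI(2) by (simp add: Un_absorb2)
  ultimately show "corank ?K = 2" using cZ cA by (simp add: corank_def gK)
qed

lemma degree_le_rank:
  assumes "finite G" "degree_sequence S G = h_vector N" "m \<in> G"
  shows "sum m S \<le> rank N"
proof (rule ccontr)
  assume "\<not> sum m S \<le> rank N"
  then have "degree_sequence S G (sum m S) = 0" using assms(2) by (simp add: h_vector_def)
  then show False using assms(1,3) by (auto simp: degree_sequence_def)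
qed

text \<open>
  Firing \<open>{i}\<close> requires \<open>m i \<ge> |C \<inter> D|\<close>, since \<open>C - D\<close> is the part of the circuit \<open>C\<close>
  already paid for by the baseline at \<open>R\<close>. But \<open>C \<inter> D\<close> is the ground set of the dead node, whose
  rank is \<open>|C \<inter> D| - 2\<close> and bounds the degree of \<open>m\<close>.
\<close>

lemma no_singleton_fires:
  assumes M: "matroid M" and B: "basis M B"
    and i: "i \<in> ground M - B" and j: "j \<in> ground M - B" and ij: "i \<noteq> j"
    and U: "covered_once M B {i, j} \<in> indeps M"
    and G: "fibre_candidate M B {i, j} G" and m: "m \<in> G"
  shows "\<not> can_fire M B {i} (\<lambda>k. baseline M B {i, j} k + m k)"
proof
  let ?C = "fund_circuit M B i" and ?D = "fund_circuit M B j"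
  assume "can_fire M B {i} (\<lambda>k. baseline M B {i, j} k + m k)"
  then have "card ?C \<le> card (?C \<inter> sym_diff ?C ?D) + m i"
    using baseline_singleton[OF M B i] covered_pair(2)[OF M B i j ij]
    by (simp add: can_fire_def baseline_def)
  moreover have "?C \<inter> sym_diff ?C ?D = ?C - ?D" by auto
  moreover have "card ?C = card (?C - ?D) + card (?C \<inter> ?D)"
  proof -
    have "finite ?C" using fund_circuit(1)[OF M B i] M finite_subset
      by (auto simp: circuit_def matroid_def)
    then show ?thesis by (metis card_Diff_subset_Int card_mono finite_Int Int_lower1 le_add_diff_inverse2)
  qed
  ultimately have "card (?C \<inter> ?D) \<le> m i" by simp
  moreover have "m i \<le> rank (dead_node M B {i, j})"
  proof -
    have "sum m {i, j} \<le> rank (dead_node M B {i, j})"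
      using G m by (intro degree_le_rank[of G])
        (auto simp: fibre_candidate_def pure_multicomplex_def multicomplex_def)
    then show ?thesis using ij by simp
  qed
  ultimately show False
    using corank_two_card[OF corank_dead_node(2)[OF M B i j ij U]]
      corank_dead_node(3)[OF M B i j ij U] by simp
qed

lemma card_2_partner:
  assumes "card X = 2" "i \<in> X"
  obtains j where "X = {i, j}" "i \<noteq> j"
proof -
  obtain x y where "X = {x, y}" "x \<noteq> y" using assms(1) by (auto simp: card_2_iff)
  moreover have "i = x \<or> i = y" using assms(2) calculation by simp
  ultimately show ?thesis using that by (metis insert_commute)
qed

lemma no_proper_stratum_fires:
  assumes M: "matroid M" and B: "basis M B" and R: "card (ground M - B) = 2"
    and dead: "dead M B (ground M - B)"
    and G: "fibre_candidate M B (ground M - B) G" and m: "m \<in> G"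
    and \<tau>: "stratum M B \<tau>" "\<tau> \<subset> ground M - B"
  shows "\<not> can_fire M B \<tau> (\<lambda>k. baseline M B (ground M - B) k + m k)"
proof -
  obtain i where i: "i \<in> \<tau>" "i \<in> ground M - B" using \<tau> by (auto simp: stratum_def)
  obtain j where j: "ground M - B = {i, j}" "i \<noteq> j"
    using card_2_partner[OF R i(2)] .
  have "\<tau> = {i}" using \<tau>(2) i(1) unfolding j(1) by blast
  then show ?thesis
    using no_singleton_fires[OF M B i(2) _ j(2)] dead G m j by (auto simp: dead_def)
qed

lemma dead_imp_full:
  assumes M: "matroid M" and B: "basis M B" and R: "card (ground M - B) = 2"
    and dead: "dead M B \<sigma>"
  shows "\<sigma> = ground M - B"
proof (rule ccontr)
  assume "\<sigma> \<noteq> ground M - B"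
  then have \<sigma>: "\<sigma> \<subset> ground M - B" "\<sigma> \<noteq> {}" using dead by (auto simp: dead_def stratum_def)
  then obtain i where i: "i \<in> \<sigma>" "i \<in> ground M - B" by auto
  obtain j where j: "ground M - B = {i, j}" using card_2_partner[OF R i(2)] .
  have "\<sigma> = {i}" using \<sigma>(1) i(1) unfolding j by blast
  then show False using dead singleton_live[OF M B i(2)] by simp
qed

lemma exists_fibre_candidate:
  assumes M: "matroid M" and B: "basis M B" and R: "card (ground M - B) = 2"
    and dead: "dead M B (ground M - B)"
  shows "\<exists>F. fibre_candidate M B (ground M - B) F"
proof -
  obtain i j where ij: "ground M - B = {i, j}" "i \<noteq> j" using R by (auto simp: card_2_iff)
  have "covered_once M B {i, j} \<in> indeps M" using dead ij by (simp add: dead_def)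
  then have "matroid (dead_node M B {i, j})" "corank (dead_node M B {i, j}) = 2"
    using corank_dead_node[OF M B _ _ ij(2)] ij(1) by auto
  then show ?thesis
    using corank_two_pure_multicomplex R ij(1) by (metis fibre_candidate_def)
qed


section \<open>Fibre systems and Stanley's conjecture in corank two\<close>

theorem theorem6p7:
  fixes M :: "'a set_system"
  assumes "matroid M" and "corank M = 2"
  shows "(\<forall>B\<^sub>0 R. basis M B\<^sub>0 \<and> R = ground M - B\<^sub>0 \<longrightarrow>
            card R = 2 \<and>
            (\<forall>\<sigma>. dead M B\<^sub>0 \<sigma> \<longrightarrow> \<sigma> = R) \<and>
            (dead M B\<^sub>0 R \<longrightarrow>
               (\<forall>F. pure_multicomplex R F \<and>
                    degree_sequence R F = h_vector (dead_node M B\<^sub>0 R) \<longrightarrow>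
                    unconditional_fibre M B\<^sub>0 R F) \<and>
               (\<exists>F. pure_multicomplex R F \<and>
                    degree_sequence R F = h_vector (dead_node M B\<^sub>0 R)))) \<and>
         (\<forall>B\<^sub>0. basis M B\<^sub>0 \<longrightarrow> (\<exists>F. fibre_system M B\<^sub>0 F)) \<and>
         pure_O_sequence (h_vector M)"
proof (intro conjI)
  note M = assms(1)
  have card_R: "card (ground M - B) = 2" if B: "basis M B" for B
  proof -
    have BI: "B \<in> indeps M" using B by (simp add: basis_def)
    show ?thesis
      using card_Diff_subset[OF finite_indep[OF M BI] indep_in_ground[OF M BI]]
        rank_eq_card_basis[OF M B] corank_two_card[OF assms(2)] by simp
  qed
  show "\<forall>B\<^sub>0 R. basis M B\<^sub>0 \<and> R = ground M - B\<^sub>0 \<longrightarrow>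
            card R = 2 \<and>
            (\<forall>\<sigma>. dead M B\<^sub>0 \<sigma> \<longrightarrow> \<sigma> = R) \<and>
            (dead M B\<^sub>0 R \<longrightarrow>
               (\<forall>F. pure_multicomplex R F \<and>
                    degree_sequence R F = h_vector (dead_node M B\<^sub>0 R) \<longrightarrow>
                    unconditional_fibre M B\<^sub>0 R F) \<and>
               (\<exists>F. pure_multicomplex R F \<and>
                    degree_sequence R F = h_vector (dead_node M B\<^sub>0 R)))"
  proof (intro allI impI, elim conjE, intro conjI allI impI)
    fix B R assume B: "basis M B" and R: "R = ground M - B"
    note c = card_R[OF B]
    show "card R = 2" using c R by simp
    show "\<sigma> = R" if "dead M B \<sigma>" for \<sigma>
      using dead_imp_full[OF M B c that] R by simp
    assume dead: "dead M B R"
    show "unconditional_fibre M B R F"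
      if "pure_multicomplex R F \<and> degree_sequence R F = h_vector (dead_node M B R)" for F
    proof -
      have "fibre_candidate M B R F" using that by (simp add: fibre_candidate_def)
      then show ?thesis
        using no_proper_stratum_fires[OF M B c] dead unfolding unconditional_fibre_def R by blast
    qed
    show "\<exists>F. pure_multicomplex R F \<and> degree_sequence R F = h_vector (dead_node M B R)"
      using exists_fibre_candidate[OF M B c] dead R by (simp add: fibre_candidate_def)
  qed
  show "\<forall>B\<^sub>0. basis M B\<^sub>0 \<longrightarrow> (\<exists>F. fibre_system M B\<^sub>0 F)"
  proof (intro allI impI)
    fix B assume B: "basis M B"
    note c = card_R[OF B]
    \<comment> \<open>Since no proper stratum fires, the fibres need not be chosen compatibly.\<close>
    define F where "F = (\<lambda>\<sigma>. SOME G. fibre_candidate M B \<sigma> G)"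
    have "fibre M B F \<sigma> (F \<sigma>)" if d: "dead M B \<sigma>" for \<sigma>
    proof -
      have \<sigma>: "\<sigma> = ground M - B" by (rule dead_imp_full[OF M B c d])
      have "fibre_candidate M B \<sigma> (F \<sigma>)"
        unfolding F_def using exists_fibre_candidate[OF M B c] d \<sigma> by (metis someI_ex)
      then show ?thesis
        using no_proper_stratum_fires[OF M B c] d unfolding fibre_def \<sigma> by blast
    qed
    then show "\<exists>F. fibre_system M B F" by (auto simp: fibre_system_def)
  qed
  have "card {..<2::nat} = 2" by simp
  then show "pure_O_sequence (h_vector M)"
    using corank_two_pure_multicomplex[OF assms] unfolding pure_O_sequence_def by metis
qed

end
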